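(* Let $b>1$ be a real number. Let $Y$ be a random variable uniformly distributed on $[1,b]$ and let $X=\log_b Y$. Then $$\delta\big(nX\bmod 1,\,U[0,1)\big)\le\frac{\ln b}{8n}\quad\text{for all }n\in\mathbb{N}.$$
   Context: Here $\mathbb{N}$ is the set of positive integers. For a real number $x$, $x\bmod 1=x-\lfloor x\rfloor\in[0,1)$. $U[0,1)$ denotes the uniform distribution on $[0,1)$. The total variation distance between (the distributions of) two real random variables $X,Y$ is $\delta(X,Y)=\sup\{|P(X\in A)-P(Y\in A)| : A\subseteq\mathbb{R}\text{ Borel}\}$. *)

theory Defs
  imports "HOL-Probability.Probability"
begin

text \<open>
  Total variation distance between two Borel distributions on the reals; for real random variables
  it is applied to their distributions \<^term>\<open>distr M borel X\<close>. The supremum is taken in the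
  conditionally complete order of the reals; for probability measures the set is bounded by 1.
\<close>
definition tv_dist :: "real measure \<Rightarrow> real measure \<Rightarrow> real" where
  "tv_dist \<mu> \<nu> = (SUP A\<in>sets (borel :: real measure). \<bar>measure \<mu> A - measure \<nu> A\<bar>)"

end

theory Submission
  imports Defs
begin

text \<open>
  Put \<open>c = ln b / n\<close>. Summing over the integer parts of \<open>n X\<close> gives a geometric series, which shows
  that \<open>n X mod 1\<close> has distribution function \<open>F t = (exp (c t) - 1) / (exp c - 1)\<close> on \<open>[0, 1)\<close>.
  The density of \<open>F\<close> is increasing, so the total variation distance to the uniform distribution is
  \<open>t - F t\<close> at the point \<open>t\<close> where the density equals 1. Since \<open>c t = ln (1 + F t (exp c - 1))\<close>,
  Hoeffding's lemma for a Bernoulli variable with parameter \<open>F t\<close> bounds \<open>c t\<close> by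
  \<open>c F t + c\<^sup>2 / 8\<close>.
\<close>

text \<open>\<open>I\<close> is the favourable set of a Hahn decomposition of
  \<open>\<nu> - \<mu>\<close>. Passing from any \<open>A\<close> to \<open>I\<close> drops
  \<open>A - I\<close>, where the signed measure is nonpositive, and adds \<open>I - A\<close>,
  where it is nonnegative, so \<open>I\<close> maximises it.\<close>

lemma tv_dist_le_Hahn:
  assumes "prob_space \<mu>" "prob_space \<nu>"
    and sets: "sets \<mu> = sets borel" "sets \<nu> = sets borel" "I \<in> sets borel"
    and le: "\<And>B. B \<in> sets borel \<Longrightarrow> B \<subseteq> I \<Longrightarrow> measure \<mu> B \<le> measure \<nu> B"
    and ge: "\<And>B. B \<in> sets borel \<Longrightarrow> B \<inter> I = {} \<Longrightarrow> measure \<nu> B \<le> measure \<mu> B"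
  shows "tv_dist \<mu> \<nu> \<le> measure \<nu> I - measure \<mu> I"
proof -
  interpret \<mu>: prob_space \<mu> by fact
  interpret \<nu>: prob_space \<nu> by fact
  have [simp]: "space \<mu> = UNIV" "space \<nu> = UNIV"
    using sets_eq_imp_space_eq[OF sets(1)] sets_eq_imp_space_eq[OF sets(2)] by simp_all
  have one_sided: "measure \<nu> A - measure \<mu> A \<le> measure \<nu> I - measure \<mu> I"
    if A: "A \<in> sets borel" for A
  proof -
    have mem: "A \<in> sets \<mu>" "I \<in> sets \<mu>" "A \<in> sets \<nu>" "I \<in> sets \<nu>"
      using sets A by auto
    have "measure \<mu> (I - A) = measure \<mu> I - measure \<mu> (A \<inter> I)"
      "measure \<nu> (I - A) = measure \<nu> I - measure \<nu> (A \<inter> I)"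
      using \<mu>.finite_measure_Diff'[OF mem(2,1)] \<nu>.finite_measure_Diff'[OF mem(4,3)]
      by (simp_all only: Int_commute)
    moreover note \<mu>.finite_measure_Diff'[OF mem(1,2)] \<nu>.finite_measure_Diff'[OF mem(3,4)]
    moreover have "measure \<nu> (A - I) \<le> measure \<mu> (A - I)"
      by (rule ge) (use A sets(3) in auto)
    moreover have "measure \<mu> (I - A) \<le> measure \<nu> (I - A)"
      by (rule le) (use A sets(3) in auto)
    ultimately show ?thesis by linarith
  qed
  have "\<bar>measure \<mu> A - measure \<nu> A\<bar> \<le> measure \<nu> I - measure \<mu> I" if A: "A \<in> sets borel" for A
  proof -
    \<comment> \<open>Both total masses are 1, so complementation flips the sign of the difference
      and the one-sided bound controls the absolute value.\<close>
    have "measure \<mu> (- A) = 1 - measure \<mu> A" "measure \<nu> (- A) = 1 - measure \<nu> A"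
      using \<mu>.prob_compl[of A] \<nu>.prob_compl[of A] A sets by (simp_all add: Compl_eq_Diff_UNIV)
    with one_sided[of A] one_sided[of "- A"] A show ?thesis by auto
  qed
  then show ?thesis
    unfolding tv_dist_def by (intro cSUP_least) auto
qed

text \<open>The derivative of \<open>F\<close>: an exponential law with negative rate
  \<open>- c\<close>, conditioned on the unit interval.\<close>

definition trunc_exp_density :: "real \<Rightarrow> real \<Rightarrow> real" where
  "trunc_exp_density c x = indicator {0..<1} x * (c * exp (c * x) / (exp c - 1))"

lemma measurable_trunc_exp_density [measurable]: "trunc_exp_density c \<in> borel_measurable borel"
  unfolding trunc_exp_density_def by measurable

definition trunc_exp :: "real \<Rightarrow> real measure" where
  "trunc_exp c = density lborel (\<lambda>x. ennreal (trunc_exp_density c x))"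

lemma sets_trunc_exp [simp]: "sets (trunc_exp c) = sets borel"
  and space_trunc_exp [simp]: "space (trunc_exp c) = UNIV"
  by (simp_all add: trunc_exp_def)

text \<open>The loose conditions on \<open>A\<close> let one integral serve \<open>{0..<t}\<close>,
  \<open>{..t}\<close> and the whole space, with rays ending outside the unit interval covered by
  \<open>t = 0\<close> or \<open>t = 1\<close>.\<close>

lemma emeasure_trunc_exp_interval:
  assumes "c > 0" "0 \<le> t" "t \<le> 1" "A \<in> sets borel" "A \<inter> {0..<1} \<subseteq> {0..t}" "{0..<t} \<subseteq> A"
  shows "emeasure (trunc_exp c) A = ennreal ((exp (c * t) - 1) / (exp c - 1))"
proof -
  have "emeasure (trunc_exp c) A = (\<integral>\<^sup>+x. ennreal (trunc_exp_density c x) * indicator A x \<partial>lborel)"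
    unfolding trunc_exp_def using assms by (subst emeasure_density) auto
  also have "\<dots> = (\<integral>\<^sup>+x. ennreal (c * exp (c * x) / (exp c - 1)) * indicator {0..t} x \<partial>lborel)"
  proof (rule nn_integral_cong_AE)
    show "AE x in lborel. ennreal (trunc_exp_density c x) * indicator A x =
        ennreal (c * exp (c * x) / (exp c - 1)) * indicator {0..t} x"
      \<comment> \<open>The integrands can differ only at \<open>x = t\<close>: membership of
        \<open>t\<close> in \<open>A\<close> is left open, and for \<open>t = 1\<close> the density
        vanishes there.\<close>
      using AE_lborel_singleton[of t]
    proof eventually_elim
      case (elim x)
      then show ?case
        using assms(3,5,6)
        by (cases "x \<in> {0..<1}"; cases "x < t"; cases "x \<in> A")
           (auto simp: trunc_exp_density_def indicator_def subset_eq)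
    qed
  qed
  also have "\<dots> = ennreal (exp (c * t) / (exp c - 1) - exp (c * 0) / (exp c - 1))"
    using assms by (intro nn_integral_FTC_Icc) (auto intro!: derivative_eq_intros)
  finally show ?thesis by (simp add: diff_divide_distrib)
qed

lemma measure_trunc_exp_interval:
  assumes "c > 0" "0 \<le> t" "t \<le> 1" "A \<in> sets borel" "A \<inter> {0..<1} \<subseteq> {0..t}" "{0..<t} \<subseteq> A"
  shows "measure (trunc_exp c) A = (exp (c * t) - 1) / (exp c - 1)"
  using emeasure_trunc_exp_interval[OF assms] assms by (simp add: measure_def)

lemma prob_space_trunc_exp: "c > 0 \<Longrightarrow> prob_space (trunc_exp c)"
  by (intro prob_spaceI) (subst emeasure_trunc_exp_interval[where t = 1]; auto)

lemma Hoeffding_trunc_exp: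
  fixes c t :: real
  assumes "c > 0" "t \<ge> 0"
  shows "t - (exp (c * t) - 1) / (exp c - 1) \<le> c / 8"
proof -
  define p where "p = (exp (c * t) - 1) / (exp c - 1)"
  have "p \<ge> 0" and "1 + p * (exp c - 1) = exp (c * t)"
    using assms by (auto simp: p_def)
  then have "- c * p + c * t \<le> c\<^sup>2 / 8"
    using Hoeffdings_lemma_aux[of c p] assms by simp
  then have "c * (t - p) \<le> c * (c / 8)"
    by (simp add: algebra_simps power2_eq_square)
  then show ?thesis
    using assms unfolding p_def by (subst (asm) mult_le_cancel_left_pos) auto
qed

lemma tv_dist_trunc_exp_uniform:
  assumes c: "c > 0"
  shows "tv_dist (trunc_exp c) (uniform_measure lborel {0..<1}) \<le> c / 8"
proof -
  \<comment> \<open>The solution of \<open>c * exp (c * t) = exp c - 1\<close>, where the density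
    crosses 1.\<close>
  define t where "t = ln ((exp c - 1) / c) / c"
  let ?U = "uniform_measure lborel {0..<1::real}"
  have ect: "exp (c * t) = (exp c - 1) / c"
    using c by (simp add: t_def)
  have "exp c \<ge> 1 + c" by (rule exp_ge_add_one_self)
  then have "exp (c * 0) \<le> exp (c * t)"
    using c unfolding ect by (simp add: field_simps)
  then have t0: "t \<ge> 0" using c by (simp del: mult_zero_right add: zero_le_mult_iff)
  \<comment> \<open>The tangent inequality at \<open>c\<close> gave \<open>t \<ge> 0\<close>; at
    \<open>- c\<close> it gives \<open>t \<le> 1\<close>.\<close>
  have "exp (- c) \<ge> 1 + (- c)" by (rule exp_ge_add_one_self)
  then have "exp c * exp (- c) \<ge> exp c * (1 + (- c))" by (intro mult_left_mono) auto
  then have "exp (c * t) \<le> exp (c * 1)"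
    using c unfolding ect by (simp add: field_simps exp_minus)
  then have t1: "t \<le> 1" using c by simp
  \<comment> \<open>With both laws as Lebesgue densities, the two Hahn conditions reduce to
    comparing the density with 1 pointwise.\<close>
  have U: "?U = density lborel (\<lambda>x. ennreal (indicator {0..<1} x))"
    unfolding uniform_measure_def by (intro density_cong) (auto split: split_indicator)
  have density_le: "c * exp (c * x) / (exp c - 1) \<le> 1 \<longleftrightarrow> x \<le> t" for x
  proof -
    have "c * exp (c * x) / (exp c - 1) \<le> 1 \<longleftrightarrow> exp (c * x) \<le> exp (c * t)"
      using c unfolding ect by (simp add: field_simps)
    also have "\<dots> \<longleftrightarrow> x \<le> t" using c by simp
    finally show ?thesis .
  qed
  interpret U: prob_space ?U by (intro prob_space_uniform_measure) auto
  interpret E: prob_space "trunc_exp c" by (rule prob_space_trunc_exp[OF c])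
  have "tv_dist (trunc_exp c) ?U \<le> measure ?U {0..<t} - measure (trunc_exp c) {0..<t}"
  proof (rule tv_dist_le_Hahn)
    fix B :: "real set" assume B: "B \<in> sets borel" "B \<subseteq> {0..<t}"
    have "emeasure (trunc_exp c) B \<le> emeasure ?U B"
      unfolding U trunc_exp_def using B t1 density_le
      by (auto simp: emeasure_density trunc_exp_density_def less_imp_le
          intro!: nn_integral_mono split: split_indicator)
    then show "measure (trunc_exp c) B \<le> measure ?U B"
      by (simp add: E.emeasure_eq_measure U.emeasure_eq_measure)
  next
    fix B :: "real set" assume B: "B \<in> sets borel" "B \<inter> {0..<t} = {}"
    have "1 \<le> c * exp (c * x) / (exp c - 1)" if "x \<in> B" "x \<ge> 0" for x
      \<comment> \<open>Here \<open>x \<ge> t\<close>. The negation of \<open>density_le\<close>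
        covers \<open>x > t\<close>; at \<open>x = t\<close> the density is exactly 1.\<close>
      using density_le[of x] density_le[of t] B that c
      by (cases "x = t") (force simp: ect)+
    then have "emeasure ?U B \<le> emeasure (trunc_exp c) B"
      unfolding U trunc_exp_def using B
      by (auto simp: emeasure_density trunc_exp_density_def
          intro!: nn_integral_mono split: split_indicator)
    then show "measure ?U B \<le> measure (trunc_exp c) B"
      by (simp add: E.emeasure_eq_measure U.emeasure_eq_measure)
  qed (auto intro: prob_space_trunc_exp c U.prob_space_axioms)
  also have "measure ?U {0..<t} = t"
    using t0 t1 by (simp add: Int_absorb1)
  also have "measure (trunc_exp c) {0..<t} = (exp (c * t) - 1) / (exp c - 1)"
    using c t0 t1 by (intro measure_trunc_exp_interval) auto
  also have "t - (exp (c * t) - 1) / (exp c - 1) \<le> c / 8"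
    by (rule Hoeffding_trunc_exp[OF c t0])
  finally show ?thesis .
qed

text \<open>In the coordinate \<open>z = ln y / c\<close> the range is \<open>0 \<le> z < n\<close>,
  and \<open>k\<close> is the integer part of \<open>z\<close>. The right endpoint is left out
  because \<open>z = n\<close> has fractional part 0 but lies in no interval with
  \<open>k < n\<close>.\<close>

lemma frac_ln_le_eq_UN_intervals:
  fixes c t :: real
  assumes c: "c > 0" and t: "0 \<le> t" "t < 1"
  shows "{1..<exp (c * real n)} \<inter> {y. frac (ln y / c) \<le> t} =
    (\<Union>k<n. {exp (c * real k)..exp (c * (real k + t))})"
proof (intro equalityI subsetI)
  fix y assume y: "y \<in> {1..<exp (c * real n)} \<inter> {y. frac (ln y / c) \<le> t}"
  define z where "z = ln y / c"
  have y_eq: "y = exp (c * z)" using y c by (simp add: z_def)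
  have "0 \<le> z" "z < real n" using y c unfolding y_eq by (auto simp: zero_le_mult_iff)
  then have "nat \<lfloor>z\<rfloor> < n" and "real (nat \<lfloor>z\<rfloor>) = z - frac z"
    by (auto simp: frac_def) linarith
  moreover have "frac z \<le> t" "frac z \<ge> 0" using y by (simp_all add: z_def)
  ultimately show "y \<in> (\<Union>k<n. {exp (c * real k)..exp (c * (real k + t))})"
    using c unfolding y_eq by (intro UN_I[of "nat \<lfloor>z\<rfloor>"]) auto
next
  fix y assume "y \<in> (\<Union>k<n. {exp (c * real k)..exp (c * (real k + t))})"
  then obtain k where k: "k < n" "exp (c * real k) \<le> y" "y \<le> exp (c * (real k + t))" by auto
  have "y > 0" using k(2) exp_gt_zero[of "c * real k"] by linarith
  define z where "z = ln y / c"
  have y_eq: "y = exp (c * z)" using \<open>y > 0\<close> c by (simp add: z_def)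
  have z: "real k \<le> z" "z \<le> real k + t" using k c unfolding y_eq by auto
  moreover from z t have "\<lfloor>z\<rfloor> = int k" by (intro floor_unique) auto
  ultimately have "frac z \<le> t" "0 \<le> z" "z < real n"
    using k(1) t by (auto simp: frac_def)
  then show "y \<in> {1..<exp (c * real n)} \<inter> {y. frac (ln y / c) \<le> t}"
    using c unfolding y_eq by auto
qed

lemma measure_frac_ln_le:
  fixes c t :: real
  assumes c: "c > 0" and t: "0 \<le> t" "t < 1" and n: "n > 0"
  shows "measure (uniform_measure lborel {1..exp (c * real n)}) {y. frac (ln y / c) \<le> t} =
    (exp (c * t) - 1) / (exp c - 1)"
proof -
  let ?b = "exp (c * real n)"
  have b: "?b > 1" using c n by simp
  have S [measurable]: "{y. frac (ln y / c) \<le> t} \<in> sets borel"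
    unfolding frac_def by measurable
  have fin: "emeasure lborel {exp (c * real k)..exp (c * (real k + t))} \<noteq> \<infinity>" for k
    by (simp add: emeasure_lborel_Icc_eq)
  have disj: "disjoint_family_on (\<lambda>k. {exp (c * real k)..exp (c * (real k + t))}) {..<n}"
  proof -
    have "k \<le> j"
      if "exp (c * real k) \<le> x" "x \<le> exp (c * (real j + t))" for j k x
    proof -
      have "exp (c * real k) \<le> exp (c * (real j + t))" using that by (rule order_trans)
      then have "real k \<le> real j + t" using c by simp
      then show ?thesis using t by linarith
    qed
    \<comment> \<open>A common point of two intervals gives the inequality of indices in both
      directions.\<close>
    then show ?thesis
      unfolding disjoint_family_on_def disjoint_iff atLeastAtMost_iff by (meson antisym)
  qed
  \<comment> \<open>Dropping the null point \<open>?b\<close> makes the decomposition into intervals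
    applicable.\<close>
  have "measure lborel ({1..?b} \<inter> {y. frac (ln y / c) \<le> t}) =
      measure lborel ({1..<?b} \<inter> {y. frac (ln y / c) \<le> t})"
    using AE_lborel_singleton[of ?b]
    by (intro measure_eq_AE) (auto elim!: eventually_mono)
  also have "\<dots> = (\<Sum>k<n. measure lborel {exp (c * real k)..exp (c * (real k + t))})"
    unfolding frac_ln_le_eq_UN_intervals[OF c t]
    using disj fin by (intro measure_finite_Union) auto
  also have "\<dots> = (\<Sum>k<n. (exp (c * t) - 1) * exp c ^ k)"
    using c t by (intro sum.cong) (auto simp: algebra_simps exp_add exp_of_nat2_mult)
  also have "\<dots> = (exp (c * t) - 1) * ((exp c ^ n - 1) / (exp c - 1))"
    using c by (simp add: sum_distrib_left[symmetric] geometric_sum)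
  also have "exp c ^ n = ?b"
    by (simp add: exp_of_nat2_mult)
  \<comment> \<open>Normalising by the length \<open>?b - 1\<close> cancels the numerator of the
    geometric sum, so \<open>n\<close> survives only through \<open>c\<close>.\<close>
  finally show ?thesis
    using b n by (subst measure_uniform_measure) auto
qed

lemma distr_frac_ln_uniform:
  assumes c: "c > 0" and n: "n > 0"
  shows "distr (uniform_measure lborel {1..exp (c * real n)}) borel (\<lambda>y. frac (ln y / c)) = trunc_exp c"
    (is "distr ?U borel ?g = _")
proof -
  have b: "exp (c * real n) > 1" using c n by simp
  interpret U: prob_space ?U
    using b n by (intro prob_space_uniform_measure) auto
  have g [measurable]: "?g \<in> borel_measurable borel"
    unfolding frac_def by measurable
  have cdf_distr: "cdf (distr ?U borel ?g) t = measure ?U {y. ?g y \<le> t}" for t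
    unfolding cdf_def by (subst measure_distr) (auto simp: vimage_def)
  interpret E: prob_space "trunc_exp c" by (rule prob_space_trunc_exp[OF c])
  have "cdf (distr ?U borel ?g) t = cdf (trunc_exp c) t" for t
  proof -
    consider "t < 0" | "0 \<le> t" "t < 1" | "t \<ge> 1" by linarith
    then show ?thesis
    proof cases
      case 1
      then have "{y. ?g y \<le> t} = {}"
        by (auto simp: not_le intro: less_le_trans frac_ge_0)
      \<comment> \<open>The ray misses the support, so the interval formula is used at 0 instead of
        at \<open>t\<close>.\<close>
      moreover have "measure (trunc_exp c) {..t} = (exp (c * 0) - 1) / (exp c - 1)"
        using 1 c by (intro measure_trunc_exp_interval) auto
      ultimately show ?thesis
        unfolding cdf_distr by (simp add: cdf_def)
    next
      case 2
      have "measure (trunc_exp c) {..t} = (exp (c * t) - 1) / (exp c - 1)"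
        using 2 c by (intro measure_trunc_exp_interval) auto
      with 2 show ?thesis
        unfolding cdf_distr using measure_frac_ln_le[OF c 2 n] by (simp add: cdf_def)
    next
      case 3
      then have "{y. ?g y \<le> t} = space ?U"
        by (auto intro: order_trans[OF less_imp_le[OF frac_lt_1]])
      moreover have "measure (trunc_exp c) {..t} = (exp (c * 1) - 1) / (exp c - 1)"
        using 3 c by (intro measure_trunc_exp_interval) auto
      ultimately show ?thesis
        unfolding cdf_distr using c U.prob_space by (simp add: cdf_def)
    qed
  qed
  moreover have "real_distribution (trunc_exp c)"
    by unfold_locales simp_all
  ultimately show ?thesis
    by (intro cdf_unique U.real_distribution_distr ext) auto
qed

theorem theorem6:
  fixes b :: real and M :: "'a measure" and X Y :: "'a \<Rightarrow> real"
  assumes "b > 1"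
    and "prob_space M"
    and "Y \<in> borel_measurable M"
    and "distr M borel Y = uniform_measure lborel {1..b}"
    and "X = (\<lambda>\<omega>. log b (Y \<omega>))"
  shows "\<forall>n::nat. n \<ge> 1 \<longrightarrow>
    tv_dist (distr M borel (\<lambda>\<omega>. frac (real n * X \<omega>))) (uniform_measure lborel {0..<1})
      \<le> ln b / (8 * real n)"
proof (intro allI impI)
  fix n :: nat assume n: "n \<ge> 1"
  \<comment> \<open>With this \<open>c\<close>, \<open>n * log b y = ln y / c\<close>, so
    multiplication by \<open>n\<close> is absorbed into the scale, and \<open>c / 8\<close> is the
    claimed bound.\<close>
  define c where "c = ln b / real n"
  have c: "c > 0" using assms(1) n by (simp add: c_def)
  have b_eq: "b = exp (c * real n)" using assms(1) n by (simp add: c_def)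
  have g [measurable]: "(\<lambda>y::real. frac (ln y / c)) \<in> borel_measurable borel"
    unfolding frac_def by measurable
  have "(\<lambda>\<omega>. frac (real n * X \<omega>)) = (\<lambda>y. frac (ln y / c)) \<circ> Y"
    using assms(1) n by (auto simp: assms(5) c_def log_def field_simps)
  then have "distr M borel (\<lambda>\<omega>. frac (real n * X \<omega>)) =
      distr (distr M borel Y) borel (\<lambda>y. frac (ln y / c))"
    using assms(3) by (simp add: distr_distr)
  also have "\<dots> = trunc_exp c"
    unfolding assms(4) b_eq using c n by (intro distr_frac_ln_uniform) auto
  finally show "tv_dist (distr M borel (\<lambda>\<omega>. frac (real n * X \<omega>))) (uniform_measure lborel {0..<1})
      \<le> ln b / (8 * real n)"
    using tv_dist_trunc_exp_uniform[OF c] by (simp add: c_def mult.commute)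
qed

end
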